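(* Let $X$ be a real Banach space. The restriction of every $g\in\mathrm{Lsc}^{\natural\natural}(X)$ to any line segment $[\bar x,\bar x+u]\subset\mathrm{dom}\, g$ is continuous at the endpoints and locally Lipschitz at every $x\in\,]\bar x,\bar x+u[$; in particular, $g^r(x;u)$ is finite for all $x\in\,]\bar x,\bar x+u[$.
   Context: All functions $f:X\to\,]-\infty,+\infty]$ are lower semicontinuous (lsc) and proper, i.e. $\mathrm{dom} f:=\{x: f(x)<\infty\}\neq\emptyset$. $[x,y]:=\{x+t(y-x):t\in[0,1]\}$, and $]x,y[$, $[x,y[$ are defined accordingly. For $\bar x\in\mathrm{dom} f$, $u\in X$: $f^r(\bar x;u):=\liminf_{t\searrow0}\frac{f(\bar x+tu)-f(\bar x)}{t}$; for $\bar x\notin\mathrm{dom} f$, $f^r(\bar x;u):=-\infty$. For $\bar x\in\mathrm{dom} f$, $f^{\natural\natural}(\bar x;u):=\inf_{\alpha\ge0}\limsup_{x\to\bar x}f^r(x;u+\alpha(\bar x-x))$, where $x=\bar x$ is allowed in the $\limsup$. $\mathrm{Lsc}(X)$ is the class of all (proper) lsc functions on $X$. $\mathrm{Lsc}^{\natural\natural}(X)$ is the class of $g\in\mathrm{Lsc}(X)$ with $\mathrm{dom}\, g$ convex such that for all $[\bar x,\bar x+u]\subset\mathrm{dom}\, g$, with $\bar x_t=\bar x+tu$, one has $g^r(\bar x_t;u)<+\infty$ and $g^{\natural\natural}(\bar x_t;u)=g^r(\bar x_t;u)$ for all $t\in[0,1[$. The restriction of $g$ to the segment is locally Lipschitz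 at $x\in\,]\bar x,\bar x+u[$ if there exist $t_0>0$ and $\lambda>0$ such that $g(z)-g(y)\le\lambda\|z-y\|$ for all $y,z\in\,]x-t_0u,x+t_0u[$. *)

theory Defs
  imports "HOL-Analysis.Analysis"
begin

definition eff_dom :: "('a \<Rightarrow> ereal) \<Rightarrow> 'a set" where
  "eff_dom f = {x. f x < \<infinity>}"

text \<open>The conjunct excluding \<open>-\<infinity>\<close> restricts the range \<^typ>\<open>ereal\<close> to \<open>]-\<infinity>, +\<infinity>]\<close>.\<close>

definition Lsc :: "('a::real_normed_vector \<Rightarrow> ereal) set" where
  "Lsc = {f. (\<forall>x. f x \<noteq> -\<infinity>) \<and> eff_dom f \<noteq> {} \<and> (\<forall>x. f x \<le> Liminf (nhds x) f)}"

definition radial_subderivative ::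
    "('a::real_normed_vector \<Rightarrow> ereal) \<Rightarrow> 'a \<Rightarrow> 'a \<Rightarrow> ereal" where
  "radial_subderivative f x u =
     (if x \<in> eff_dom f
      then Liminf (at_right (0::real)) (\<lambda>t. (f (x + t *\<^sub>R u) - f x) / ereal t)
      else -\<infinity>)"

text \<open>The filter is \<^term>\<open>nhds xb\<close> rather than \<^term>\<open>at xb\<close> because \<open>x = xb\<close> is allowed in the
  limit superior. The value is meant, and used below, only for \<open>xb\<close> in the effective domain.\<close>

definition natural_subderivative ::
    "('a::real_normed_vector \<Rightarrow> ereal) \<Rightarrow> 'a \<Rightarrow> 'a \<Rightarrow> ereal" where
  "natural_subderivative f xb u =
     (INF \<alpha>\<in>{0::real..}.
        Limsup (nhds xb) (\<lambda>x. radial_subderivative f x (u + \<alpha> *\<^sub>R (xb - x))))"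

definition Lsc_natural :: "('a::real_normed_vector \<Rightarrow> ereal) set" where
  "Lsc_natural = {g \<in> Lsc. convex (eff_dom g) \<and>
     (\<forall>xb u. closed_segment xb (xb + u) \<subseteq> eff_dom g \<longrightarrow>
        (\<forall>t\<in>{0::real..<1}.
           radial_subderivative g (xb + t *\<^sub>R u) u < \<infinity> \<and>
           natural_subderivative g (xb + t *\<^sub>R u) u = radial_subderivative g (xb + t *\<^sub>R u) u))}"

text \<open>The open segment \<open>]x, y[\<close>, parametrised by \<open>t \<in> ]0, 1[\<close>. It agrees with
  \<^term>\<open>open_segment x y\<close> unless \<open>x = y\<close>, when it is \<open>{x}\<close> and not empty.\<close>

definition oseg :: "'a::real_vector \<Rightarrow> 'a \<Rightarrow> 'a set" where
  "oseg x y = {x + t *\<^sub>R (y - x) | t::real. 0 < t \<and> t < 1}"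

text \<open>Since \<open>\<infinity> - \<infinity> = \<infinity>\<close> in \<^typ>\<open>ereal\<close>, for functions that never take the value \<open>-\<infinity>\<close> the
  inequality also forces finiteness on the small segment.\<close>

definition locally_Lipschitz_along ::
    "('a::real_normed_vector \<Rightarrow> ereal) \<Rightarrow> 'a \<Rightarrow> 'a \<Rightarrow> bool" where
  "locally_Lipschitz_along g u x \<longleftrightarrow>
     (\<exists>t0>0. \<exists>L>0. \<forall>y\<in>oseg (x - t0 *\<^sub>R u) (x + t0 *\<^sub>R u). \<forall>z\<in>oseg (x - t0 *\<^sub>R u) (x + t0 *\<^sub>R u).
        g z - g y \<le> ereal (L * norm (z - y)))"

end

theory Submission
  imports Defs
begin

text \<open>
  The radial condition on \<open>g\<close> is one-sided, and the reverse bounds come from applying it to the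
  reversed segment. If \<open>x\<close> is a point of the segment (other than its end), then the natural
  subderivative of \<open>g\<close> at \<open>x\<close> in the direction \<open>u\<close> is not \<open>+\<infinity>\<close>, being equal to the radial
  one. Its limit superior runs over all of a neighbourhood of \<open>x\<close>, in particular over the points
  \<open>x + s u\<close>, where the tilted direction \<open>u + \<alpha> (x - (x + s u))\<close> is the multiple \<open>(1 - \<alpha> s) u\<close>
  of \<open>u\<close>. Hence one real bound controls the lower Dini derivatives of \<open>s \<mapsto> g (x + s u)\<close> at all
  small \<open>s\<close> at once (\<open>uniform_small_steps_of_natural_subderivative_finite\<close>).

  For a lower semicontinuous function of one variable such a pointwise bound integrates: each
  point where the function lies below a line of slope \<open>K\<close> is followed by another one, and
  lower semicontinuity allows passing to the supremum (\<open>growth_bound_of_small_steps\<close>).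
  This gives \<open>g (x + b u) - g (x + a u) \<le> K (b - a)\<close> for small \<open>a \<le> b\<close>.

  At an interior point the same holds for \<open>- u\<close>, and the two one-sided bounds make \<open>g\<close>
  Lipschitz near the point; the difference quotients are then bounded, so the radial
  subderivative is finite. At an endpoint only the bound from the endpoint inwards is available; it
  gives upper semicontinuity there along the segment, and lower semicontinuity is assumed.
\<close>

section \<open>A mean value inequality for lower semicontinuous functions\<close>

lemma Lsc_eventually_gt:
  fixes g :: "'a::real_normed_vector \<Rightarrow> ereal"
  assumes "g \<in> Lsc" "c < g x"
  shows "eventually (\<lambda>y. c < g y) (nhds x)"
proof -
  have "g x \<le> Liminf (nhds x) g" using assms(1) by (simp add: Lsc_def)
  then show ?thesis using assms(2) by (simp add: le_Liminf_iff)
qed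

lemma Lsc_ne_MInfty: "g \<in> Lsc \<Longrightarrow> g x \<noteq> -\<infinity>"
  by (simp add: Lsc_def)

text \<open>A mean value inequality with only a lower right Dini derivative at hand: the set \<open>S\<close> of points
  where \<open>f\<close> is below the line of slope \<open>K\<close> through the left endpoint contains its supremum, by
  lower semicontinuity, and a supremum short of \<open>b\<close> would be overtaken by one more step. On \<open>S\<close> the
  function stays below \<open>+\<infinity>\<close>, so that the step condition may be restricted to such points; that \<open>f\<close>
  is below \<open>+\<infinity>\<close> at \<open>b\<close> is then a conclusion.\<close>

lemma growth_bound_of_small_steps:
  fixes f :: "real \<Rightarrow> ereal"
  assumes lsc: "\<And>c s. c < f s \<Longrightarrow> eventually (\<lambda>r. c < f r) (nhds s)"
    and fa: "f a = ereal v" and ab: "a \<le> b"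
    and step: "\<And>s \<epsilon>. a \<le> s \<Longrightarrow> s < b \<Longrightarrow> f s < \<infinity> \<Longrightarrow> 0 < \<epsilon> \<Longrightarrow>
      \<exists>\<sigma>. 0 < \<sigma> \<and> \<sigma> < \<epsilon> \<and> f (s + \<sigma>) \<le> f s + ereal (K * \<sigma>)"
  shows "f b \<le> ereal (v + K * (b - a))"
proof -
  define S where "S = {s. a \<le> s \<and> s \<le> b \<and> f s \<le> ereal (v + K * (s - a))}"
  define m where "m = Sup S"
  have aS: "a \<in> S" using fa ab by (simp add: S_def)
  have bdd: "bdd_above S" by (rule bdd_aboveI[of _ b]) (simp add: S_def)
  have am: "a \<le> m" unfolding m_def using aS bdd by (rule cSup_upper)
  have mb: "m \<le> b" unfolding m_def using aS by (intro cSup_least) (auto simp: S_def)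
  have fm: "f m \<le> ereal (v + K * (m - a))"
  proof (rule ccontr)
    assume "\<not> ?thesis"
    then have "ereal (v + K * (m - a)) < f m" by simp
    then obtain c where c: "v + K * (m - a) < c" "ereal c < f m"
      using ereal_dense2 by fastforce
    have cont: "((\<lambda>s. v + K * (s - a)) \<longlongrightarrow> v + K * (m - a)) (nhds m)"
      by (intro tendsto_intros filterlim_ident)
    have "eventually (\<lambda>s. v + K * (s - a) < c) (nhds m)"
      using order_tendstoD(2)[OF cont c(1)] .
    with lsc[OF c(2)] have "eventually (\<lambda>s. s \<notin> S) (nhds m)"
    proof eventually_elim
      case (elim s)
      have "ereal (v + K * (s - a)) < ereal c" using elim by simp
      also have "\<dots> < f s" using elim by simp
      finally have "\<not> f s \<le> ereal (v + K * (s - a))" by (simp only: not_le)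
      then show ?case by (simp add: S_def)
    qed
    then obtain d where d: "d > 0" "\<And>s. dist s m < d \<Longrightarrow> s \<notin> S"
      unfolding eventually_nhds_metric by blast
    obtain s where s: "s \<in> S" "m - d < s"
    proof (rule less_cSupE[of "m - d" S])
      show "m - d < Sup S" using d(1) by (simp add: m_def)
    qed (use aS in auto)
    then have "s \<le> m" unfolding m_def using bdd by (intro cSup_upper)
    then have "dist s m < d" using s by (simp add: dist_real_def)
    then show False using d(2) s(1) by blast
  qed
  have "m = b"
  proof (rule ccontr)
    assume "m \<noteq> b"
    then have mb': "m < b" using mb by simp
    have "f m < \<infinity>" using fm by (rule order.strict_trans1) simp
    then obtain \<sigma> where \<sigma>: "0 < \<sigma>" "\<sigma> < b - m" "f (m + \<sigma>) \<le> f m + ereal (K * \<sigma>)"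
      using step[OF am mb', of "b - m"] mb' by auto
    have "f m + ereal (K * \<sigma>) \<le> ereal (v + K * (m - a)) + ereal (K * \<sigma>)"
      using fm by (rule add_right_mono)
    also have "\<dots> = ereal (v + K * (m + \<sigma> - a))" by (simp add: algebra_simps)
    finally have "m + \<sigma> \<in> S" using \<sigma> am by (auto simp: S_def)
    then have "m + \<sigma> \<le> m" unfolding m_def using bdd by (intro cSup_upper)
    then show False using \<sigma>(1) by simp
  qed
  then show ?thesis using fm by simp
qed

section \<open>One-sided bounds from the natural subderivative\<close>

lemma small_step_of_radial_subderivative_less:
  fixes g :: "'a::real_normed_vector \<Rightarrow> ereal"
  assumes "x \<in> eff_dom g" "g x \<noteq> -\<infinity>" "radial_subderivative g x v < ereal K" "0 < \<epsilon>"
  shows "\<exists>\<tau>. 0 < \<tau> \<and> \<tau> < \<epsilon> \<and> g (x + \<tau> *\<^sub>R v) \<le> g x + ereal (K * \<tau>)"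
proof (rule ccontr)
  assume none: "\<not> ?thesis"
  obtain w where w: "g x = ereal w"
    using assms(1,2) by (cases "g x") (auto simp: eff_dom_def)
  have "eventually (\<lambda>t. ereal K \<le> (g (x + t *\<^sub>R v) - g x) / ereal t) (at_right 0)"
    using eventually_at_right_less[of 0] eventually_at_right_real[OF assms(4)]
  proof eventually_elim
    case (elim t)
    then have t: "0 < t" and less: "ereal (w + K * t) < g (x + t *\<^sub>R v)" using none w by auto
    then show ?case
      using w by (cases "g (x + t *\<^sub>R v)") (auto simp: field_simps)
  qed
  then have "ereal K \<le> radial_subderivative g x v"
    using assms(1) by (simp add: radial_subderivative_def Liminf_bounded)
  then show False using assms(3) by simp
qed

text \<open>This is what the tilt \<open>\<alpha>\<close> costs on the line through \<open>x\<close>: it only rescales the direction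
  \<open>u\<close>, by a factor that tends to 1 at \<open>x\<close>. A factor in \<open>]1/2, 2[\<close> changes the bound on the
  slopes at most by a factor 2.\<close>

lemma uniform_small_steps_of_natural_subderivative_finite:
  fixes g :: "'a::real_normed_vector \<Rightarrow> ereal"
  assumes g: "g \<in> Lsc" and fin: "natural_subderivative g x u < \<infinity>"
  obtains K \<delta> where "0 < K" "0 < \<delta>"
    "\<And>s \<epsilon>. \<bar>s\<bar> < \<delta> \<Longrightarrow> x + s *\<^sub>R u \<in> eff_dom g \<Longrightarrow> 0 < \<epsilon> \<Longrightarrow>
      \<exists>\<sigma>. 0 < \<sigma> \<and> \<sigma> < \<epsilon> \<and> g (x + (s + \<sigma>) *\<^sub>R u) \<le> g (x + s *\<^sub>R u) + ereal (K * \<sigma>)"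
proof -
  obtain \<alpha> :: real where \<alpha>_mem: "\<alpha> \<in> {0..}" and \<alpha>_fin:
    "Limsup (nhds x) (\<lambda>y. radial_subderivative g y (u + \<alpha> *\<^sub>R (x - y))) < \<infinity>"
    using fin unfolding natural_subderivative_def INF_less_iff by blast
  have \<alpha>: "0 \<le> \<alpha>" using \<alpha>_mem by simp
  obtain c where c:
    "Limsup (nhds x) (\<lambda>y. radial_subderivative g y (u + \<alpha> *\<^sub>R (x - y))) < ereal c"
    using ereal_dense2[OF \<alpha>_fin] by auto
  \<comment> \<open>The slope bound must be nonnegative to survive the rescaling by a factor above \<open>1/2\<close>.\<close>
  define C where "C = max c 1"
  have ev: "eventually (\<lambda>y. radial_subderivative g y (u + \<alpha> *\<^sub>R (x - y)) < ereal c) (nhds x)"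
    using c by (rule Limsup_lessD)
  have "((\<lambda>s. x + s *\<^sub>R u) \<longlongrightarrow> x + 0 *\<^sub>R u) (nhds 0)"
    by (intro tendsto_intros filterlim_ident)
  then have "filterlim (\<lambda>s. x + s *\<^sub>R u) (nhds x) (nhds 0)" by simp
  from eventually_compose_filterlim[OF ev this]
  obtain d where d: "d > 0" "\<And>s. \<bar>s\<bar> < d \<Longrightarrow>
      radial_subderivative g (x + s *\<^sub>R u) (u + \<alpha> *\<^sub>R (x - (x + s *\<^sub>R u))) < ereal c"
    unfolding eventually_nhds_metric dist_real_def by auto
  \<comment> \<open>The second bound gives \<open>\<bar>\<alpha> s\<bar> < 1/2\<close>; the summand 1 covers \<open>\<alpha> = 0\<close>.\<close>
  define \<delta> where "\<delta> = min d (1 / (2 * (\<alpha> + 1)))"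
  show thesis
  proof (rule that[of "2 * C" \<delta>])
    show "0 < 2 * C" by (simp add: C_def)
    show "0 < \<delta>" using d(1) \<alpha> by (simp add: \<delta>_def)
    fix s \<epsilon> :: real
    assume s: "\<bar>s\<bar> < \<delta>" and dom: "x + s *\<^sub>R u \<in> eff_dom g" and \<epsilon>: "0 < \<epsilon>"
    define \<rho> where "\<rho> = 1 - \<alpha> * s"
    have "\<bar>s\<bar> * (\<alpha> + 1) < 1 / 2"
      using s \<alpha> by (simp add: \<delta>_def field_simps)
    moreover have "\<bar>\<alpha> * s\<bar> \<le> \<bar>s\<bar> * (\<alpha> + 1)"
      using \<alpha> by (simp add: abs_mult algebra_simps)
    ultimately have "\<bar>\<alpha> * s\<bar> < 1 / 2" by simp
    then have \<rho>: "1 / 2 < \<rho>" "\<rho> < 2" unfolding \<rho>_def abs_less_iff by linarith+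
    have dir: "u + \<alpha> *\<^sub>R (x - (x + s *\<^sub>R u)) = \<rho> *\<^sub>R u"
      by (simp add: \<rho>_def algebra_simps)
    have "radial_subderivative g (x + s *\<^sub>R u) (\<rho> *\<^sub>R u) < ereal c"
      using d(2)[of s] s by (simp add: dir[symmetric] \<delta>_def)
    from small_step_of_radial_subderivative_less[OF dom Lsc_ne_MInfty[OF g] this, of "\<epsilon> / 2"] \<epsilon>
    obtain \<tau> where \<tau>: "0 < \<tau>" "\<tau> < \<epsilon> / 2"
      "g (x + s *\<^sub>R u + \<tau> *\<^sub>R \<rho> *\<^sub>R u) \<le> g (x + s *\<^sub>R u) + ereal (c * \<tau>)" by auto
    have "c * \<tau> \<le> C * \<tau>" using \<tau>(1) by (simp add: C_def)
    also have "\<dots> \<le> C * (2 * (\<tau> * \<rho>))" using \<tau>(1) \<rho>(1) by (intro mult_left_mono) (auto simp: C_def)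
    finally have "ereal (c * \<tau>) \<le> ereal (2 * C * (\<tau> * \<rho>))" by (simp add: mult_ac)
    then have "g (x + s *\<^sub>R u) + ereal (c * \<tau>) \<le> g (x + s *\<^sub>R u) + ereal (2 * C * (\<tau> * \<rho>))"
      by (rule add_left_mono)
    with \<tau>(3) have "g (x + (s + \<tau> * \<rho>) *\<^sub>R u) \<le> g (x + s *\<^sub>R u) + ereal (2 * C * (\<tau> * \<rho>))"
      by (simp add: scaleR_add_left add.assoc)
    moreover have "\<tau> * \<rho> < \<epsilon>"
    proof -
      have "\<tau> * \<rho> \<le> \<tau> * 2" using \<tau>(1) \<rho>(2) by (intro mult_left_mono) auto
      then show ?thesis using \<tau>(2) by simp
    qed
    moreover have "0 < \<tau> * \<rho>" using \<tau>(1) \<rho>(1) by simp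
    ultimately show "\<exists>\<sigma>. 0 < \<sigma> \<and> \<sigma> < \<epsilon> \<and>
        g (x + (s + \<sigma>) *\<^sub>R u) \<le> g (x + s *\<^sub>R u) + ereal (2 * C * \<sigma>)" by blast
  qed
qed

text \<open>The mean value inequality carries membership in the effective domain from \<open>x + a u\<close> to
  \<open>x + b u\<close>. For \<open>a = 0\<close> the bound thus shows that \<open>g\<close> is finite a little further along \<open>u\<close>.\<close>

lemma one_sided_Lipschitz_of_natural_subderivative_finite:
  fixes g :: "'a::real_normed_vector \<Rightarrow> ereal"
  assumes g: "g \<in> Lsc" and fin: "natural_subderivative g x u < \<infinity>"
  obtains K \<delta> where "0 < K" "0 < \<delta>"
    "\<And>a b. - \<delta> < a \<Longrightarrow> a \<le> b \<Longrightarrow> b < \<delta> \<Longrightarrow> x + a *\<^sub>R u \<in> eff_dom g \<Longrightarrow>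
      g (x + b *\<^sub>R u) \<le> g (x + a *\<^sub>R u) + ereal (K * (b - a))"
proof -
  obtain K \<delta> where K: "0 < K" "0 < \<delta>" and
    step: "\<And>s \<epsilon>. \<bar>s\<bar> < \<delta> \<Longrightarrow> x + s *\<^sub>R u \<in> eff_dom g \<Longrightarrow> 0 < \<epsilon> \<Longrightarrow>
      \<exists>\<sigma>. 0 < \<sigma> \<and> \<sigma> < \<epsilon> \<and> g (x + (s + \<sigma>) *\<^sub>R u) \<le> g (x + s *\<^sub>R u) + ereal (K * \<sigma>)"
    using uniform_small_steps_of_natural_subderivative_finite[OF g fin] by blast
  show thesis
  proof (rule that[OF K])
    fix a b
    assume ab: "- \<delta> < a" "a \<le> b" "b < \<delta>" and dom: "x + a *\<^sub>R u \<in> eff_dom g"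
    obtain v where v: "g (x + a *\<^sub>R u) = ereal v"
      using dom Lsc_ne_MInfty[OF g, of "x + a *\<^sub>R u"]
      by (cases "g (x + a *\<^sub>R u)") (auto simp: eff_dom_def)
    have "g (x + b *\<^sub>R u) \<le> ereal (v + K * (b - a))"
    proof (rule growth_bound_of_small_steps[where f = "\<lambda>s. g (x + s *\<^sub>R u)"])
      fix c s assume "c < g (x + s *\<^sub>R u)"
      then have "eventually (\<lambda>y. c < g y) (nhds (x + s *\<^sub>R u))" by (rule Lsc_eventually_gt[OF g])
      moreover have "((\<lambda>r. x + r *\<^sub>R u) \<longlongrightarrow> x + s *\<^sub>R u) (nhds s)"
        by (intro tendsto_intros filterlim_ident)
      ultimately show "eventually (\<lambda>r. c < g (x + r *\<^sub>R u)) (nhds s)"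
        by (rule eventually_compose_filterlim)
    next
      fix s \<epsilon> :: real
      assume "a \<le> s" "s < b" "g (x + s *\<^sub>R u) < \<infinity>" "0 < \<epsilon>"
      then show "\<exists>\<sigma>. 0 < \<sigma> \<and> \<sigma> < \<epsilon> \<and> g (x + (s + \<sigma>) *\<^sub>R u) \<le> g (x + s *\<^sub>R u) + ereal (K * \<sigma>)"
        using ab by (intro step) (auto simp: eff_dom_def)
    qed (use v ab in auto)
    then show "g (x + b *\<^sub>R u) \<le> g (x + a *\<^sub>R u) + ereal (K * (b - a))" by (simp add: v)
  qed
qed

section \<open>Local Lipschitz continuity and its consequences\<close>

lemma oseg_symmetric_eq:
  fixes x u :: "'a::real_vector"
  assumes "0 < r"
  shows "oseg (x - r *\<^sub>R u) (x + r *\<^sub>R u) = {x + s *\<^sub>R u | s. \<bar>s\<bar> < r}"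
proof (intro equalityI subsetI)
  fix y assume "y \<in> oseg (x - r *\<^sub>R u) (x + r *\<^sub>R u)"
  then obtain t where t: "0 < t" "t < 1"
    "y = x - r *\<^sub>R u + t *\<^sub>R ((x + r *\<^sub>R u) - (x - r *\<^sub>R u))"
    by (auto simp: oseg_def)
  have "y = x + (r * (2 * t - 1)) *\<^sub>R u"
    by (simp add: t(3) algebra_simps flip: scaleR_2)
  moreover have "\<bar>r * (2 * t - 1)\<bar> < r"
    using t assms by (auto simp: abs_mult)
  ultimately show "y \<in> {x + s *\<^sub>R u | s. \<bar>s\<bar> < r}" by blast
next
  fix y assume "y \<in> {x + s *\<^sub>R u | s. \<bar>s\<bar> < r}"
  then obtain s where s: "\<bar>s\<bar> < r" "y = x + s *\<^sub>R u" by blast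
  define t where "t = (s / r + 1) / 2"
  have st: "s = r * (2 * t - 1)" using assms by (simp add: t_def field_simps)
  have "y = x - r *\<^sub>R u + t *\<^sub>R ((x + r *\<^sub>R u) - (x - r *\<^sub>R u))"
    by (simp add: s(2) st algebra_simps flip: scaleR_2)
  moreover have "0 < t" "t < 1" using s(1) assms by (auto simp: t_def field_simps abs_if split: if_splits)
  ultimately show "y \<in> oseg (x - r *\<^sub>R u) (x + r *\<^sub>R u)" by (auto simp: oseg_def)
qed

text \<open>The bound in the direction \<open>u\<close> limits the increase of \<open>g\<close> along \<open>u\<close>, the bound in the
  direction \<open>- u\<close> its decrease. Both start from \<open>x\<close> as well, which makes \<open>g\<close> finite on a whole
  interval around \<open>x\<close>.\<close>

lemma locally_Lipschitz_along_of_two_sided: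
  fixes g :: "'a::real_normed_vector \<Rightarrow> ereal"
  assumes g: "g \<in> Lsc" and dom: "x \<in> eff_dom g"
    and "natural_subderivative g x u < \<infinity>" "natural_subderivative g x (- u) < \<infinity>"
  shows "locally_Lipschitz_along g u x"
proof -
  obtain K1 \<delta>1 where 1: "0 < K1" "0 < \<delta>1"
    "\<And>a b. - \<delta>1 < a \<Longrightarrow> a \<le> b \<Longrightarrow> b < \<delta>1 \<Longrightarrow> x + a *\<^sub>R u \<in> eff_dom g \<Longrightarrow>
      g (x + b *\<^sub>R u) \<le> g (x + a *\<^sub>R u) + ereal (K1 * (b - a))"
    using one_sided_Lipschitz_of_natural_subderivative_finite[OF g assms(3)] by blast
  obtain K2 \<delta>2 where 2: "0 < K2" "0 < \<delta>2"
    "\<And>a b. - \<delta>2 < a \<Longrightarrow> a \<le> b \<Longrightarrow> b < \<delta>2 \<Longrightarrow> x + a *\<^sub>R - u \<in> eff_dom g \<Longrightarrow>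
      g (x + b *\<^sub>R - u) \<le> g (x + a *\<^sub>R - u) + ereal (K2 * (b - a))"
    using one_sided_Lipschitz_of_natural_subderivative_finite[OF g assms(4)] by blast
  define K where "K = max K1 K2"
  define \<delta> where "\<delta> = min \<delta>1 \<delta>2"
  have K: "0 < K" "0 < \<delta>" using 1(1,2) 2(1,2) by (auto simp: K_def \<delta>_def)
  have up: "g (x + s *\<^sub>R u) \<le> g (x + r *\<^sub>R u) + ereal (K * \<bar>s - r\<bar>)"
    if sr: "\<bar>s\<bar> < \<delta>" "\<bar>r\<bar> < \<delta>" and d: "x + r *\<^sub>R u \<in> eff_dom g" for s r
  proof (cases "r \<le> s")
    case True
    then have "g (x + s *\<^sub>R u) \<le> g (x + r *\<^sub>R u) + ereal (K1 * (s - r))"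
      using sr d by (intro 1(3)) (auto simp: \<delta>_def)
    also have "\<dots> \<le> g (x + r *\<^sub>R u) + ereal (K * \<bar>s - r\<bar>)"
      using True by (intro add_left_mono) (auto simp: K_def intro: mult_right_mono)
    finally show ?thesis .
  next
    case False
    then have "g (x + (- s) *\<^sub>R - u) \<le> g (x + (- r) *\<^sub>R - u) + ereal (K2 * (- s - - r))"
      using sr d by (intro 2(3)) (auto simp: \<delta>_def)
    also have "\<dots> \<le> g (x + (- r) *\<^sub>R - u) + ereal (K * \<bar>s - r\<bar>)"
      using False by (intro add_left_mono) (auto simp: K_def intro: mult_mono)
    finally show ?thesis by simp
  qed
  have fin: "\<bar>g (x + s *\<^sub>R u)\<bar> \<noteq> \<infinity>" if "\<bar>s\<bar> < \<delta>" for s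
  proof -
    have "g (x + s *\<^sub>R u) \<le> g x + ereal (K * \<bar>s\<bar>)"
      using up[of s 0] that K dom by simp
    also have "\<dots> < \<infinity>" using dom by (simp add: eff_dom_def)
    finally show ?thesis using Lsc_ne_MInfty[OF g, of "x + s *\<^sub>R u"] by auto
  qed
  define L where "L = (if u = 0 then 1 else K / norm u)"
  have L: "0 < L" using K(1) by (simp add: L_def)
  have "g (x + s *\<^sub>R u) - g (x + r *\<^sub>R u) \<le> ereal (L * norm ((x + s *\<^sub>R u) - (x + r *\<^sub>R u)))"
    if sr: "\<bar>s\<bar> < \<delta>" "\<bar>r\<bar> < \<delta>" for s r
  proof (cases "u = 0")
    case True
    then show ?thesis using fin[OF sr(1)] by (cases "g x") auto
  next
    case False
    have "norm ((x + s *\<^sub>R u) - (x + r *\<^sub>R u)) = \<bar>s - r\<bar> * norm u"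
      by (simp flip: scaleR_diff_left)
    then have "L * norm ((x + s *\<^sub>R u) - (x + r *\<^sub>R u)) = K * \<bar>s - r\<bar>"
      using False by (simp add: L_def)
    moreover have "g (x + s *\<^sub>R u) \<le> g (x + r *\<^sub>R u) + ereal (K * \<bar>s - r\<bar>)"
      using up[OF sr] fin[OF sr(2)] by (auto simp: eff_dom_def)
    ultimately show ?thesis using fin[OF sr(1)] fin[OF sr(2)]
      by (cases "g (x + s *\<^sub>R u)"; cases "g (x + r *\<^sub>R u)") auto
  qed
  then show ?thesis unfolding locally_Lipschitz_along_def
    using K(2) L by (intro exI[of _ \<delta>] conjI exI[of _ L]) (auto simp: oseg_symmetric_eq)
qed

lemma locally_Lipschitz_along_imp_radial_subderivative_finite:
  fixes g :: "'a::real_normed_vector \<Rightarrow> ereal"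
  assumes "locally_Lipschitz_along g u x"
  shows "\<bar>radial_subderivative g x u\<bar> \<noteq> \<infinity>"
proof -
  obtain \<delta> L where \<delta>: "0 < \<delta>" and L: "0 < L" and lip: "\<And>s r. \<bar>s\<bar> < \<delta> \<Longrightarrow> \<bar>r\<bar> < \<delta> \<Longrightarrow>
      g (x + s *\<^sub>R u) - g (x + r *\<^sub>R u) \<le> ereal (L * norm ((x + s *\<^sub>R u) - (x + r *\<^sub>R u)))"
    using assms unfolding locally_Lipschitz_along_def
    by (fastforce simp: oseg_symmetric_eq)
  define M where "M = L * norm u"
  obtain w where w: "g x = ereal w"
    using lip[of 0 0] \<delta> by (cases "g x") auto
  have bounds: "eventually (\<lambda>t. - ereal M \<le> (g (x + t *\<^sub>R u) - g x) / ereal t \<and>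
      (g (x + t *\<^sub>R u) - g x) / ereal t \<le> ereal M) (at_right 0)"
    using eventually_at_right_less[of 0] eventually_at_right_real[OF \<delta>]
  proof eventually_elim
    case (elim t)
    then have t: "0 < t" "\<bar>t\<bar> < \<delta>" by auto
    have "g (x + t *\<^sub>R u) - g x \<le> ereal (M * t)" "g x - g (x + t *\<^sub>R u) \<le> ereal (M * t)"
      using lip[of t 0] lip[of 0 t] t \<delta> by (simp_all add: M_def mult_ac)
    then show ?case using t(1) w
      by (cases "g (x + t *\<^sub>R u)") (auto simp: field_simps)
  qed
  have rad: "radial_subderivative g x u =
      Liminf (at_right 0) (\<lambda>t. (g (x + t *\<^sub>R u) - g x) / ereal t)"
    using w by (simp add: radial_subderivative_def eff_dom_def)
  have "- ereal M \<le> radial_subderivative g x u"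
    unfolding rad by (rule Liminf_bounded) (use bounds in eventually_elim, simp)
  moreover have "radial_subderivative g x u \<le> Limsup (at_right 0) (\<lambda>t. (g (x + t *\<^sub>R u) - g x) / ereal t)"
    unfolding rad by (rule Liminf_le_Limsup) simp
  moreover have "\<dots> \<le> ereal M"
    by (rule Limsup_bounded) (use bounds in eventually_elim, simp)
  ultimately show ?thesis by (cases "radial_subderivative g x u") auto
qed

text \<open>The increase of \<open>g\<close> from \<open>x\<close> is at most linear in the distance to \<open>x\<close>, which gives upper
  semicontinuity at \<open>x\<close> along the segment.\<close>

lemma continuous_at_segment_endpoint:
  fixes g :: "'a::real_normed_vector \<Rightarrow> ereal"
  assumes g: "g \<in> Lsc" and dom: "x \<in> eff_dom g" and fin: "natural_subderivative g x u < \<infinity>"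
  shows "continuous (at x within closed_segment x (x + u)) g"
proof (cases "u = 0")
  case True
  have "\<forall>y\<in>{x}. continuous (at y within {x}) g"
    using continuous_on_sing[of x g] unfolding continuous_on_eq_continuous_within .
  then show ?thesis using True by simp
next
  case False
  obtain K \<delta> where K: "0 < K" "0 < \<delta>" and
    bound: "\<And>a b. - \<delta> < a \<Longrightarrow> a \<le> b \<Longrightarrow> b < \<delta> \<Longrightarrow> x + a *\<^sub>R u \<in> eff_dom g \<Longrightarrow>
      g (x + b *\<^sub>R u) \<le> g (x + a *\<^sub>R u) + ereal (K * (b - a))"
    using one_sided_Lipschitz_of_natural_subderivative_finite[OF g fin] by blast
  obtain w where w: "g x = ereal w"
    using dom Lsc_ne_MInfty[OF g, of x] by (cases "g x") (auto simp: eff_dom_def)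
  show ?thesis unfolding continuous_within
  proof (rule order_tendstoI)
    fix c assume "c < g x"
    from Lsc_eventually_gt[OF g this]
    show "eventually (\<lambda>y. c < g y) (at x within closed_segment x (x + u))"
      by (simp add: eventually_at_filter eventually_mono)
  next
    fix c assume "g x < c"
    then obtain c' where c': "w < c'" "ereal c' < c"
      using ereal_dense2 w by fastforce
    define \<eta> where "\<eta> = min \<delta> ((c' - w) / K)"
    have \<eta>: "0 < \<eta>" using K c' by (simp add: \<eta>_def)
    have "g y < c" if y: "y \<in> closed_segment x (x + u)" "dist y x < \<eta> * norm u" for y
    proof -
      obtain s where s: "0 \<le> s" "y = x + s *\<^sub>R u"
        using y(1) by (auto simp: closed_segment_def algebra_simps)
      then have s\<eta>: "s < \<eta>" using y(2) False by (simp add: dist_norm)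
      then have "g y \<le> ereal (w + K * s)"
        using bound[of 0 s] s K dom w by (simp add: \<eta>_def)
      also have "\<dots> \<le> ereal c'"
        using s\<eta> K(1) by (simp add: \<eta>_def field_simps)
      finally show ?thesis using c'(2) by simp
    qed
    moreover have "0 < \<eta> * norm u" using \<eta> False by simp
    ultimately show "eventually (\<lambda>y. g y < c) (at x within closed_segment x (x + u))"
      unfolding eventually_at by blast
  qed
qed

section \<open>Functions with equal natural and radial subderivatives\<close>

lemma Lsc_natural_natural_subderivative_finite:
  fixes g :: "'a::real_normed_vector \<Rightarrow> ereal"
  assumes "g \<in> Lsc_natural" "closed_segment xb (xb + u) \<subseteq> eff_dom g" "0 \<le> t" "t < 1"
  shows "natural_subderivative g (xb + t *\<^sub>R u) u < \<infinity>"
proof -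
  have "\<forall>t\<in>{0::real..<1}. radial_subderivative g (xb + t *\<^sub>R u) u < \<infinity> \<and>
      natural_subderivative g (xb + t *\<^sub>R u) u = radial_subderivative g (xb + t *\<^sub>R u) u"
    using assms(1,2) by (simp add: Lsc_natural_def)
  then show ?thesis using assms(3,4) by simp
qed

theorem proposition4p1:
  fixes g :: "'a::banach \<Rightarrow> ereal" and xb u :: 'a
  assumes "g \<in> Lsc_natural"
    and "closed_segment xb (xb + u) \<subseteq> eff_dom g"
  shows "continuous (at xb within closed_segment xb (xb + u)) g \<and>
    continuous (at (xb + u) within closed_segment xb (xb + u)) g \<and>
    (\<forall>x\<in>oseg xb (xb + u). locally_Lipschitz_along g u x) \<and>
    (\<forall>x\<in>oseg xb (xb + u). \<bar>radial_subderivative g x u\<bar> \<noteq> \<infinity>)"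
proof -
  have g: "g \<in> Lsc" using assms(1) by (simp add: Lsc_natural_def)
  have rev: "closed_segment (xb + u) (xb + u + - u) \<subseteq> eff_dom g"
    using assms(2) by (simp add: closed_segment_commute)
  have fwd: "natural_subderivative g (xb + t *\<^sub>R u) u < \<infinity>" if "0 \<le> t" "t < 1" for t
    using Lsc_natural_natural_subderivative_finite[OF assms that] .
  have bwd: "natural_subderivative g (xb + t *\<^sub>R u) (- u) < \<infinity>" if "0 < t" "t \<le> 1" for t
  proof -
    have "natural_subderivative g (xb + u + (1 - t) *\<^sub>R - u) (- u) < \<infinity>"
      by (rule Lsc_natural_natural_subderivative_finite[OF assms(1) rev]) (use that in auto)
    moreover have "xb + u + (1 - t) *\<^sub>R - u = xb + t *\<^sub>R u" by (simp add: algebra_simps)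
    ultimately show ?thesis by (simp only:)
  qed
  have lip: "locally_Lipschitz_along g u x" if x: "x \<in> oseg xb (xb + u)" for x
  proof -
    obtain t where t: "0 < t" "t < 1" "x = xb + t *\<^sub>R u" using x by (auto simp: oseg_def)
    then have "x \<in> closed_segment xb (xb + u)"
      by (auto simp: closed_segment_def algebra_simps intro!: exI[of _ t])
    then show ?thesis
      using locally_Lipschitz_along_of_two_sided[OF g] fwd[of t] bwd[of t] t assms(2) by auto
  qed
  have "continuous (at xb within closed_segment xb (xb + u)) g"
    using continuous_at_segment_endpoint[OF g] fwd[of 0] assms(2) by auto
  moreover have "continuous (at (xb + u) within closed_segment xb (xb + u)) g"
    using continuous_at_segment_endpoint[OF g, of "xb + u" "- u"] bwd[of 1] assms(2)
    by (simp add: closed_segment_commute subset_iff)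
  moreover have "\<bar>radial_subderivative g x u\<bar> \<noteq> \<infinity>" if "x \<in> oseg xb (xb + u)" for x
    using locally_Lipschitz_along_imp_radial_subderivative_finite[OF lip[OF that]] .
  ultimately show ?thesis using lip by (intro conjI ballI)
qed

end
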